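(* Let $n\ge 3$. In the asynchronous read-write shared memory model with $n$ processes, there is no conflict-obstruction-free universal construction. That is, there is no algorithm that takes as input an arbitrary sequential object specification $(Q,q_0,O,R,\sigma)$ and produces a linearizable implementation of that object for $n$ processes, from atomic read-write registers, that is conflict-obstruction-free.
   Context: **Objects.** A sequential object is a tuple $(Q,q_0,O,R,\sigma)$: $Q$ a set of states, $q_0\in Q$ the initial state, $O$ a set of operations, $R$ a set of responses, $\sigma:O\times Q\to R\times Q$ a state transition function giving the response and next state. For a sequence $s\in O^*$ and $q\in Q$, $s(q)$ is the state obtained by applying the operations of $s$ in order from $q$; $s\cdot s'$ is concatenation. Operations $o,o'\in O$ commute in state $q$ if $o\cdot o'(q)=o'\cdot o(q)$ and each of the two operations returns the same response in both orders. They conflict, written $o\asymp o'$, if there is a state $q\in Q$ in which they do not commute. **Model.** There are $n$ asynchronous deterministic processes communicating through atomic read-write registers. Any number of processes may crash (stop taking steps); there are no timing or fairness assumptions. An implementation (algorithm) consists of one deterministic automaton per process. Each process has at most one pending operation on the implemented object at a time. When a process invokes an operation it takes steps according to its automaton; each step consists of local computation and one shared-memory event (a read or a write of one register), after which the process updates its local state and possibly returns a response to its pending operation. A configuration consists of the local states of all processes and the contents of all registers. An execution is a finite or infinite sequence of steps of the processes, following their automata, from the initial configuration. **Operation instances.** An operation instance $\Phi=(x,o,p)$ is an invocation by process $p$ of operation $o$ on object $x$. It completes in an execution $\alpha$ if it returns a response in $\alpha$; otherwise it is pending. $\Phi$ takes a step in $\alpha$ when $p$ takes a step after invoking $\Phi$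 and while $\Phi$ has not yet returned. In an infinite execution a process is correct if it takes infinitely many steps or has no pending operation; otherwise it is faulty. **Conflict-obstruction-freedom (COF).** $\Phi=(x,o,p)$ is eventually conflict-step-contention free in $\alpha$ if either $\Phi$ completes in $\alpha$, or there is a suffix of $\alpha$ in which no other operation instance $\Phi'=(x,o',q)$ with $o\asymp o'$ takes steps. An implementation is conflict-obstruction-free if, for every infinite execution $\alpha$ and every operation instance $\Phi$ invoked by a correct process that is eventually conflict-step-contention free in $\alpha$, $\Phi$ completes in $\alpha$. **Linearizability** is the standard notion: each operation appears to take effect instantaneously between its invocation and its response, consistently with the sequential specification (pending operations may be completed or dropped). *)

theory Defs
  imports Main "HOL-Library.FuncSet"
begin

section \<open>Sequential objects\<close>

record ('q, 'o, 'r) seq_object =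
  states :: "'q set"
  initial :: 'q
  operations :: "'o set"
  responses :: "'r set"
  delta :: "'o \<times> 'q \<Rightarrow> 'r \<times> 'q"

definition sequential_object :: "('q, 'o, 'r) seq_object \<Rightarrow> bool" where
  "sequential_object X \<longleftrightarrow>
     initial X \<in> states X \<and>
     delta X \<in> operations X \<times> states X \<rightarrow> responses X \<times> states X"

definition resp :: "('q, 'o, 'r) seq_object \<Rightarrow> 'o \<Rightarrow> 'q \<Rightarrow> 'r" where
  "resp X a q = fst (delta X (a, q))"

definition state_after :: "('q, 'o, 'r) seq_object \<Rightarrow> 'o list \<Rightarrow> 'q \<Rightarrow> 'q" where
  "state_after X s q = fold (\<lambda>a q'. snd (delta X (a, q'))) s q"

text \<open>For two copies of one operation, the definition asks that the first and the second copy
  get the same response; e.g. fetch-and-increment conflicts with itself.\<close>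

definition commute :: "('q, 'o, 'r) seq_object \<Rightarrow> 'o \<Rightarrow> 'o \<Rightarrow> 'q \<Rightarrow> bool" where
  "commute X a b q \<longleftrightarrow>
     state_after X [a, b] q = state_after X [b, a] q \<and>
     resp X a q = resp X a (state_after X [b] q) \<and>
     resp X b (state_after X [a] q) = resp X b q"

definition conflict :: "('q, 'o, 'r) seq_object \<Rightarrow> 'o \<Rightarrow> 'o \<Rightarrow> bool" where
  "conflict X a b \<longleftrightarrow> (\<exists>q\<in>states X. \<not> commute X a b q)"

fun legal :: "('q, 'o, 'r) seq_object \<Rightarrow> 'q \<Rightarrow> ('o \<times> 'r) list \<Rightarrow> bool" where
  "legal X q [] \<longleftrightarrow> True"
| "legal X q ((a, r) # h) \<longleftrightarrow> r = resp X a q \<and> legal X (state_after X [a] q) h"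


section \<open>Implementations from read-write registers and their executions\<close>

text \<open>Type \<open>'x\<close> indexes the registers, \<open>'v\<close> is the type of register values and \<open>'s\<close> the type of
  local states. Process \<open>p\<close> in local state \<open>s\<close> performs the shared-memory event \<open>access I p s\<close>;
  \<open>update I p s w\<close> is its next local state together with the response, if any, that it returns.
  The argument \<open>w\<close> is \<open>Some v\<close> if the event was a read that obtained \<open>v\<close>, and \<open>None\<close> if it was
  a write.\<close>

datatype ('x, 'v) memory_event = Read 'x | Write 'x 'v

record ('s, 'x, 'v, 'o, 'r) implementation =
  init_local :: "nat \<Rightarrow> 's"
  init_memory :: "'x \<Rightarrow> 'v"
  start :: "nat \<Rightarrow> 's \<Rightarrow> 'o \<Rightarrow> 's"
  access :: "nat \<Rightarrow> 's \<Rightarrow> ('x, 'v) memory_event"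
  update :: "nat \<Rightarrow> 's \<Rightarrow> 'v option \<Rightarrow> 's \<times> 'r option"

text \<open>The component \<open>pending\<close> is the part of the local states recording the pending operations.\<close>

record ('s, 'x, 'v, 'o) config =
  local_state :: "nat \<Rightarrow> 's"
  memory :: "'x \<Rightarrow> 'v"
  pending :: "nat \<Rightarrow> 'o option"

definition initial_config ::
    "('s, 'x, 'v, 'o, 'r) implementation \<Rightarrow> ('s, 'x, 'v, 'o) config" where
  "initial_config I =
     \<lparr>local_state = init_local I, memory = init_memory I, pending = (\<lambda>_. None)\<rparr>"

text \<open>\<open>Step p ro\<close> is a step of \<open>p\<close>, at the end of which \<open>p\<close> returns \<open>r\<close> if \<open>ro = Some r\<close> and
  returns nothing if \<open>ro = None\<close>. Invocations are decided by the environment and are not steps.\<close>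

datatype ('o, 'r) action = Invoke nat 'o | Step nat "'r option"

inductive transition ::
    "nat \<Rightarrow> ('q, 'o, 'r) seq_object \<Rightarrow> ('s, 'x, 'v, 'o, 'r) implementation \<Rightarrow>
     ('s, 'x, 'v, 'o) config \<Rightarrow> ('o, 'r) action \<Rightarrow> ('s, 'x, 'v, 'o) config \<Rightarrow> bool"
  for n X I where
  invoke:
    "p < n \<Longrightarrow> a \<in> operations X \<Longrightarrow> pending c p = None \<Longrightarrow>
     transition n X I c (Invoke p a)
       (c\<lparr>local_state := (local_state c)(p := start I p (local_state c p) a),
          pending := (pending c)(p := Some a)\<rparr>)"
| read_step:
    "p < n \<Longrightarrow> pending c p \<noteq> None \<Longrightarrow>
     access I p (local_state c p) = Read x \<Longrightarrow>
     update I p (local_state c p) (Some (memory c x)) = (s, ro) \<Longrightarrow>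
     transition n X I c (Step p ro)
       (c\<lparr>local_state := (local_state c)(p := s),
          pending := (if ro = None then pending c else (pending c)(p := None))\<rparr>)"
| write_step:
    "p < n \<Longrightarrow> pending c p \<noteq> None \<Longrightarrow>
     access I p (local_state c p) = Write x v \<Longrightarrow>
     update I p (local_state c p) None = (s, ro) \<Longrightarrow>
     transition n X I c (Step p ro)
       (c\<lparr>local_state := (local_state c)(p := s),
          memory := (memory c)(x := v),
          pending := (if ro = None then pending c else (pending c)(p := None))\<rparr>)"

definition finite_execution ::
    "nat \<Rightarrow> ('q, 'o, 'r) seq_object \<Rightarrow> ('s, 'x, 'v, 'o, 'r) implementation \<Rightarrow>
     ('o, 'r) action list \<Rightarrow> bool" where
  "finite_execution n X I \<alpha> \<longleftrightarrow>
     (\<exists>c. c 0 = initial_config I \<and>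
          (\<forall>k < length \<alpha>. transition n X I (c k) (\<alpha> ! k) (c (Suc k))))"

definition infinite_execution ::
    "nat \<Rightarrow> ('q, 'o, 'r) seq_object \<Rightarrow> ('s, 'x, 'v, 'o, 'r) implementation \<Rightarrow>
     (nat \<Rightarrow> ('o, 'r) action) \<Rightarrow> bool" where
  "infinite_execution n X I \<alpha> \<longleftrightarrow>
     (\<exists>c. c 0 = initial_config I \<and> (\<forall>k. transition n X I (c k) (\<alpha> k) (c (Suc k))))"


section \<open>Operation instances\<close>

text \<open>The operation instances in an execution \<open>\<alpha>\<close> are identified with the positions of their
  invocations in \<open>\<alpha>\<close>, so that repeated invocations of one operation by one process are distinct
  instances. The next two predicates look at \<open>\<alpha>\<close> only up to position \<open>k\<close> and are also used for
  finite executions \<open>xs\<close>, as \<open>(!) xs\<close> with \<open>k < length xs\<close>.\<close>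

definition step_of :: "(nat \<Rightarrow> ('o, 'r) action) \<Rightarrow> nat \<Rightarrow> nat \<Rightarrow> bool" where
  "step_of \<alpha> i k \<longleftrightarrow>
     i < k \<and>
     (\<exists>p a. \<alpha> i = Invoke p a \<and> (\<exists>ro. \<alpha> k = Step p ro) \<and>
            (\<forall>j r. i < j \<and> j < k \<longrightarrow> \<alpha> j \<noteq> Step p (Some r)))"

definition returns_at :: "(nat \<Rightarrow> ('o, 'r) action) \<Rightarrow> nat \<Rightarrow> nat \<Rightarrow> 'r \<Rightarrow> bool" where
  "returns_at \<alpha> i k r \<longleftrightarrow> step_of \<alpha> i k \<and> (\<exists>p. \<alpha> k = Step p (Some r))"

definition completes :: "(nat \<Rightarrow> ('o, 'r) action) \<Rightarrow> nat \<Rightarrow> bool" where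
  "completes \<alpha> i \<longleftrightarrow> (\<exists>k r. returns_at \<alpha> i k r)"


section \<open>Linearizability\<close>

definition precedes :: "('o, 'r) action list \<Rightarrow> nat \<Rightarrow> nat \<Rightarrow> bool" where
  "precedes \<alpha> i j \<longleftrightarrow> (\<exists>k r. k < j \<and> j < length \<alpha> \<and> returns_at ((!) \<alpha>) i k r)"

text \<open>\<open>L\<close> lists operation instances with their operations and responses. It contains all complete
  instances, with the responses they returned, and any pending instances, with arbitrary
  responses; the remaining pending instances are dropped.\<close>

definition linearization ::
    "('q, 'o, 'r) seq_object \<Rightarrow> ('o, 'r) action list \<Rightarrow> (nat \<times> 'o \<times> 'r) list \<Rightarrow> bool" where
  "linearization X \<alpha> L \<longleftrightarrow>
     distinct (map fst L) \<and>
     (\<forall>(i, a, r) \<in> set L. i < length \<alpha> \<and> (\<exists>p. \<alpha> ! i = Invoke p a)) \<and>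
     (\<forall>i k p a r. k < length \<alpha> \<and> \<alpha> ! i = Invoke p a \<and> returns_at ((!) \<alpha>) i k r
        \<longrightarrow> (i, a, r) \<in> set L) \<and>
     sorted_wrt (\<lambda>u v. \<not> precedes \<alpha> (fst v) (fst u)) L \<and>
     legal X (initial X) (map snd L)"

definition linearizable ::
    "nat \<Rightarrow> ('q, 'o, 'r) seq_object \<Rightarrow> ('s, 'x, 'v, 'o, 'r) implementation \<Rightarrow> bool" where
  "linearizable n X I \<longleftrightarrow> (\<forall>\<alpha>. finite_execution n X I \<alpha> \<longrightarrow> (\<exists>L. linearization X \<alpha> L))"


section \<open>Conflict-obstruction-freedom\<close>

definition correct :: "(nat \<Rightarrow> ('o, 'r) action) \<Rightarrow> nat \<Rightarrow> bool" where
  "correct \<alpha> p \<longleftrightarrow>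
     infinite {k. \<exists>ro. \<alpha> k = Step p ro} \<or>
     (\<forall>i a. \<alpha> i = Invoke p a \<longrightarrow> completes \<alpha> i)"

definition eventually_conflict_step_contention_free ::
    "('q, 'o, 'r) seq_object \<Rightarrow> (nat \<Rightarrow> ('o, 'r) action) \<Rightarrow> nat \<Rightarrow> bool" where
  "eventually_conflict_step_contention_free X \<alpha> i \<longleftrightarrow>
     completes \<alpha> i \<or>
     (\<exists>m. \<forall>k \<ge> m. \<forall>j p q a b.
        j \<noteq> i \<and> \<alpha> i = Invoke p a \<and> \<alpha> j = Invoke q b \<and> conflict X a b \<longrightarrow> \<not> step_of \<alpha> j k)"

definition conflict_obstruction_free ::
    "nat \<Rightarrow> ('q, 'o, 'r) seq_object \<Rightarrow> ('s, 'x, 'v, 'o, 'r) implementation \<Rightarrow> bool" where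
  "conflict_obstruction_free n X I \<longleftrightarrow>
     (\<forall>\<alpha> i p a. infinite_execution n X I \<alpha> \<and> \<alpha> i = Invoke p a \<and> correct \<alpha> p \<and>
        eventually_conflict_step_contention_free X \<alpha> i \<longrightarrow> completes \<alpha> i)"


section \<open>Universal constructions\<close>

text \<open>A construction \<open>U\<close> takes objects whose states, operations and responses are arbitrary
  subsets of the types \<open>'q\<close>, \<open>'o\<close> and \<open>'r\<close>; these types have to be infinite for the quantification
  over \<open>X\<close> to range over all finite objects up to isomorphism. \<open>U\<close> need not be computable, which
  only makes the non-existence of such a \<open>U\<close> a stronger claim.\<close>

definition universal_construction ::
    "nat \<Rightarrow> (('q, 'o, 'r) seq_object \<Rightarrow> ('s, 'x, 'v, 'o, 'r) implementation) \<Rightarrow> bool" where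
  "universal_construction n U \<longleftrightarrow> (\<forall>X. sequential_object X \<longrightarrow> linearizable n X (U X))"

definition conflict_obstruction_free_construction ::
    "nat \<Rightarrow> (('q, 'o, 'r) seq_object \<Rightarrow> ('s, 'x, 'v, 'o, 'r) implementation) \<Rightarrow> bool" where
  "conflict_obstruction_free_construction n U \<longleftrightarrow>
     (\<forall>X. sequential_object X \<longrightarrow> conflict_obstruction_free n X (U X))"

end

theory Submission
  imports Defs "HOL-Library.Infinite_Set"
begin

text \<open>The object is binary consensus: the first proposal fixes the response of all operations.
  Two proposals of the same value commute, so processes \<open>0\<close> and \<open>1\<close>, both proposing the first
  value, must decide wait-free as long as process \<open>2\<close>, proposing the second value, takes no steps.
  Let the outcome of \<open>p\<close> in a configuration be the value that \<open>p\<close> decides when it runs alone.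
  The outcomes of \<open>0\<close> and \<open>1\<close> agree in every reachable configuration: from a disagreement,
  some step or pair of steps of \<open>0\<close> and \<open>1\<close> preserves the disagreement, and repeating this gives
  an infinite execution in which neither decides. In the solo run of process \<open>2\<close> some step changes
  this common outcome. Postponing that step behind the steps of a solo run of \<open>0\<close>, one at a time,
  the change persists, because at each point either the two steps commute or one of them hides
  the other. It persists even when \<open>0\<close> has decided, which is absurd.\<close>

section \<open>The consensus object\<close>

text \<open>\<open>s\<close> is the undecided state; \<open>s0\<close> and \<open>s1\<close> record
  which value has won.\<close>

definition consensus_object ::
    "'q \<Rightarrow> 'q \<Rightarrow> 'q \<Rightarrow> 'o \<Rightarrow> 'o \<Rightarrow> 'r \<Rightarrow> 'r \<Rightarrow> ('q, 'o, 'r) seq_object" where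
  "consensus_object s s0 s1 a0 a1 r0 r1 =
     \<lparr>states = {s, s0, s1}, initial = s, operations = {a0, a1}, responses = {r0, r1},
      delta = (\<lambda>(a, q). if q = s0 \<or> q = s \<and> a = a0 then (r0, s0) else (r1, s1))\<rparr>"

lemma sequential_consensus_object: "sequential_object (consensus_object s s0 s1 a0 a1 r0 r1)"
  by (auto simp: sequential_object_def consensus_object_def)

text \<open>The first copy fixes the response and the second repeats it, so the order is invisible.
  Everything drawn from conflict-obstruction-freedom rests on this.\<close>

lemma consensus_object_no_self_conflict:
  assumes "distinct [s, s0, s1]"
  shows "\<not> conflict (consensus_object s s0 s1 a0 a1 r0 r1) a a"
  using assms
  by (auto simp: conflict_def commute_def consensus_object_def resp_def state_after_def)

text \<open>Decided states are absorbing.\<close>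

lemma legal_consensus_decided:
  assumes "distinct [s, s0, s1]" "legal (consensus_object s s0 s1 a0 a1 r0 r1) q h" "(a, r) \<in> set h"
  shows "q = s0 \<Longrightarrow> r = r0" and "q = s1 \<Longrightarrow> r = r1"
  using assms
  by (induction h arbitrary: q)
    (force simp: consensus_object_def resp_def state_after_def)+

text \<open>The first operation enters an absorbing state. Agreement and validity both come from
  here.\<close>

lemma legal_consensus_first:
  assumes "distinct [s, s0, s1]" "legal (consensus_object s s0 s1 a0 a1 r0 r1) s (h # hs)"
    and "(a, r) \<in> set (h # hs)"
  shows "r = (if fst h = a0 then r0 else r1)"
proof (cases h)
  case (Pair b u)
  let ?X = "consensus_object s s0 s1 a0 a1 r0 r1"
  let ?q = "if b = a0 then s0 else s1"
  have u: "u = (if b = a0 then r0 else r1)" and hs: "legal ?X ?q hs"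
    using assms Pair by (auto simp: consensus_object_def resp_def state_after_def split: if_splits)
  then show ?thesis
    using legal_consensus_decided[OF assms(1) hs, of a r] assms(3) Pair by (auto split: if_splits)
qed

section \<open>Configurations of one-shot processes\<close>

text \<open>Each process has invoked one operation. The second component of its view is the response
  once it has returned; from then on its steps have no effect.\<close>

record ('s, 'x, 'v, 'r) system =
  view :: "nat \<Rightarrow> 's \<times> 'r option"
  mem :: "'x \<Rightarrow> 'v"

abbreviation decision :: "('s, 'x, 'v, 'r) system \<Rightarrow> nat \<Rightarrow> 'r option" where
  "decision c p \<equiv> snd (view c p)"

definition sys_step ::
    "('s, 'x, 'v, 'o, 'r) implementation \<Rightarrow> nat \<Rightarrow> ('s, 'x, 'v, 'r) system \<Rightarrow>
     ('s, 'x, 'v, 'r) system" where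
  "sys_step I p c =
     (if decision c p \<noteq> None then c
      else case access I p (fst (view c p)) of
        Read x \<Rightarrow> c\<lparr>view := (view c)(p := update I p (fst (view c p)) (Some (mem c x)))\<rparr>
      | Write x v \<Rightarrow>
          \<lparr>view = (view c)(p := update I p (fst (view c p)) None), mem = (mem c)(x := v)\<rparr>)"

lemma sys_step_decided [simp]: "decision c p \<noteq> None \<Longrightarrow> sys_step I p c = c"
  by (simp add: sys_step_def)

lemma view_sys_step_other [simp]: "q \<noteq> p \<Longrightarrow> view (sys_step I p c) q = view c q"
  by (simp add: sys_step_def split: memory_event.split)

lemma decision_sys_step: "decision c p = Some u \<Longrightarrow> decision (sys_step I q c) p = Some u"
  by (cases "p = q") auto

lemma decision_run: "decision c p = Some u \<Longrightarrow> decision ((sys_step I q ^^ k) c) p = Some u"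
  by (induction k) (auto intro: decision_sys_step)

text \<open>Indistinguishability to every process other than \<open>p\<close>.\<close>

definition agree_except ::
    "nat \<Rightarrow> ('s, 'x, 'v, 'r) system \<Rightarrow> ('s, 'x, 'v, 'r) system \<Rightarrow> bool" where
  "agree_except p c c' \<longleftrightarrow> mem c = mem c' \<and> (\<forall>q. q \<noteq> p \<longrightarrow> view c q = view c' q)"

text \<open>Two reads commute, and so do accesses to different registers. On a common register, a
  write by \<open>q\<close> erases the trace of an earlier read or write by \<open>p\<close>,
  leaving only the view of \<open>p\<close> changed; a write by \<open>p\<close> likewise hides a
  read by \<open>q\<close>. Steps of a decided process are idle and commute with everything.\<close>

lemma sys_step_cases:
  assumes "p \<noteq> q"
  obtains (commute) "sys_step I p (sys_step I q c) = sys_step I q (sys_step I p c)"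
  | (hide_first) "agree_except p (sys_step I q (sys_step I p c)) (sys_step I q c)"
  | (hide_second) "agree_except q (sys_step I p (sys_step I q c)) (sys_step I p c)"
proof (cases "decision c p = None \<and> decision c q = None")
  case False
  then have "sys_step I p (sys_step I q c) = sys_step I q (sys_step I p c)"
    using assms by auto
  then show ?thesis by (rule commute)
next
  case True
  let ?P = "access I p (fst (view c p))" and ?Q = "access I q (fst (view c q))"
  show ?thesis
  proof (cases ?P)
    case P: (Read x)
    show ?thesis
    proof (cases ?Q)
      case Q: (Read y)
      show ?thesis
        using assms True P Q by (intro commute) (simp add: sys_step_def fun_upd_twist)
    next
      case Q: (Write y v)
      show ?thesis
      proof (cases "x = y")
        case True
        then show ?thesis
          using assms \<open>decision c p = None \<and> _\<close> P Q
          by (intro hide_first) (simp add: sys_step_def agree_except_def)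
      next
        case False
        then show ?thesis
          using assms True P Q by (intro commute) (simp add: sys_step_def fun_upd_twist)
      qed
    qed
  next
    case P: (Write x v)
    show ?thesis
    proof (cases ?Q)
      case Q: (Read y)
      show ?thesis
      proof (cases "x = y")
        case True
        then show ?thesis
          using assms \<open>decision c p = None \<and> _\<close> P Q
          by (intro hide_second) (simp add: sys_step_def agree_except_def)
      next
        case False
        then show ?thesis
          using assms True P Q by (intro commute) (simp add: sys_step_def fun_upd_twist)
      qed
    next
      case Q: (Write y w)
      show ?thesis
      proof (cases "x = y")
        case True
        then show ?thesis
          using assms \<open>decision c p = None \<and> _\<close> P Q
          by (intro hide_first) (simp add: sys_step_def agree_except_def)
      next
        case False
        then show ?thesis
          using assms True P Q by (intro commute) (simp add: sys_step_def fun_upd_twist)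
      qed
    qed
  qed
qed

section \<open>Outcomes of solo runs\<close>

definition solo_outcome ::
    "('s, 'x, 'v, 'o, 'r) implementation \<Rightarrow> nat \<Rightarrow> ('s, 'x, 'v, 'r) system \<Rightarrow> 'r \<Rightarrow> bool" where
  "solo_outcome I p c u \<longleftrightarrow> (\<exists>k. decision ((sys_step I p ^^ k) c) p = Some u)"

lemma solo_outcome_decided: "decision c p = Some u \<Longrightarrow> solo_outcome I p c u"
  unfolding solo_outcome_def by (rule exI[of _ 0]) simp

text \<open>Decisions are permanent, so both runs can be prolonged to the common length
  \<open>k + l\<close>.\<close>

lemma solo_outcome_unique:
  assumes "solo_outcome I p c u" "solo_outcome I p c v"
  shows "u = v"
proof -
  obtain k l where k: "decision ((sys_step I p ^^ k) c) p = Some u"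
    and l: "decision ((sys_step I p ^^ l) c) p = Some v"
    using assms by (auto simp: solo_outcome_def)
  have "decision ((sys_step I p ^^ (l + k)) c) p = Some u"
    using decision_run[OF k] by (simp add: funpow_add)
  moreover have "decision ((sys_step I p ^^ (k + l)) c) p = Some v"
    using decision_run[OF l] by (simp add: funpow_add)
  ultimately show ?thesis by (simp add: add.commute)
qed

text \<open>The two solo runs differ by a shift of one step; from right to left the run that reached
  \<open>u\<close> is prolonged by one step, which keeps the decision.\<close>

lemma solo_outcome_step: "solo_outcome I p (sys_step I p c) u \<longleftrightarrow> solo_outcome I p c u"
proof
  assume "solo_outcome I p (sys_step I p c) u"
  then obtain k where "decision ((sys_step I p ^^ k) (sys_step I p c)) p = Some u"
    by (auto simp: solo_outcome_def)
  then have "decision ((sys_step I p ^^ Suc k) c) p = Some u"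
    by (simp add: funpow_swap1)
  then show "solo_outcome I p c u" unfolding solo_outcome_def ..
next
  assume "solo_outcome I p c u"
  then obtain k where "decision ((sys_step I p ^^ k) c) p = Some u"
    by (auto simp: solo_outcome_def)
  from decision_sys_step[OF this, of I p]
  have "decision ((sys_step I p ^^ k) (sys_step I p c)) p = Some u"
    by (simp add: funpow_swap1)
  then show "solo_outcome I p (sys_step I p c) u" unfolding solo_outcome_def ..
qed

lemma sys_step_agree:
  assumes "mem c = mem c'" "view c p = view c' p"
  shows "mem (sys_step I p c) = mem (sys_step I p c') \<and>
    view (sys_step I p c) p = view (sys_step I p c') p"
  using assms by (simp add: sys_step_def split: memory_event.split)

text \<open>A solo run of \<open>p\<close> depends only on the memory and the view of
  \<open>p\<close>.\<close>

lemma solo_outcome_agree: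
  assumes "agree_except q c c'" "p \<noteq> q"
  shows "solo_outcome I p c u \<longleftrightarrow> solo_outcome I p c' u"
proof -
  have "mem ((sys_step I p ^^ k) c) = mem ((sys_step I p ^^ k) c') \<and>
      view ((sys_step I p ^^ k) c) p = view ((sys_step I p ^^ k) c') p" for k
  proof (induction k)
    case 0
    then show ?case using assms by (simp add: agree_except_def)
  next
    case (Suc k)
    then show ?case
      using sys_step_agree[of "(sys_step I p ^^ k) c" "(sys_step I p ^^ k) c'" p I] by simp
  qed
  then show ?thesis by (simp add: solo_outcome_def)
qed

section \<open>Executions as prefixes\<close>

text \<open>\<open>finite_execution\<close> with its last configuration exposed, so that executions
  can be prolonged.\<close>

definition leads_to ::
    "nat \<Rightarrow> ('q, 'o, 'r) seq_object \<Rightarrow> ('s, 'x, 'v, 'o, 'r) implementation \<Rightarrow>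
     ('o, 'r) action list \<Rightarrow> ('s, 'x, 'v, 'o) config \<Rightarrow> bool" where
  "leads_to n X I \<alpha> d \<longleftrightarrow>
     (\<exists>c. c 0 = initial_config I \<and> c (length \<alpha>) = d \<and>
          (\<forall>k < length \<alpha>. transition n X I (c k) (\<alpha> ! k) (c (Suc k))))"

lemma leads_to_Nil: "leads_to n X I [] (initial_config I)"
  by (auto simp: leads_to_def)

lemma leads_to_snoc:
  assumes "leads_to n X I \<alpha> d" "transition n X I d e d'"
  shows "leads_to n X I (\<alpha> @ [e]) d'"
proof -
  obtain c where c: "c 0 = initial_config I" "c (length \<alpha>) = d"
    "\<forall>k < length \<alpha>. transition n X I (c k) (\<alpha> ! k) (c (Suc k))"
    using assms(1) by (auto simp: leads_to_def)
  show ?thesis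
    unfolding leads_to_def
    by (rule exI[of _ "c(Suc (length \<alpha>) := d')"])
      (use c assms(2) in \<open>auto simp: nth_append less_Suc_eq\<close>)
qed

lemma leads_to_finite_execution: "leads_to n X I \<alpha> d \<Longrightarrow> finite_execution n X I \<alpha>"
  by (auto simp: leads_to_def finite_execution_def)

lemma leads_to_infinite_execution:
  assumes "leads_to n X I \<alpha> (d 0)" "\<And>k. transition n X I (d k) (e k) (d (Suc k))"
  shows "infinite_execution n X I (\<lambda>k. if k < length \<alpha> then \<alpha> ! k else e (k - length \<alpha>))"
proof -
  obtain c where c: "c 0 = initial_config I" "c (length \<alpha>) = d 0"
    "\<forall>k < length \<alpha>. transition n X I (c k) (\<alpha> ! k) (c (Suc k))"
    using assms(1) by (auto simp: leads_to_def)
  define c' where "c' k = (if k < length \<alpha> then c k else d (k - length \<alpha>))" for k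
  have "c' 0 = initial_config I"
    using c by (auto simp: c'_def)
  moreover have "transition n X I (c' k)
      (if k < length \<alpha> then \<alpha> ! k else e (k - length \<alpha>)) (c' (Suc k))" for k
  proof (cases "k < length \<alpha>")
    case True
    \<comment> \<open>At the junction \<open>Suc k = length \<alpha>\<close> the value of
      \<open>c'\<close> is \<open>d 0\<close>, which equals
      \<open>c (length \<alpha>)\<close>.\<close>
    then have "c' (Suc k) = c (Suc k)"
      using c(2) by (cases "Suc k = length \<alpha>") (auto simp: c'_def)
    then show ?thesis using True c(3) by (simp add: c'_def)
  next
    case False
    then show ?thesis using assms(2)[of "k - length \<alpha>"] by (simp add: c'_def Suc_diff_le)
  qed
  ultimately show ?thesis unfolding infinite_execution_def by blast
qed

lemma returns_at_append:
  assumes "k < length \<alpha>"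
  shows "returns_at ((!) (\<alpha> @ \<beta>)) i k r \<longleftrightarrow> returns_at ((!) \<alpha>) i k r"
  using assms by (auto simp: returns_at_def step_of_def nth_append)

section \<open>Implementations of consensus\<close>

text \<open>Collects what is assumed for contradiction; the context ends by deriving
  \<open>False\<close>.\<close>

locale consensus_implementation =
  fixes n :: nat and s s0 s1 :: 'q and a0 a1 :: 'o and r0 r1 :: 'r
    and X :: "('q, 'o, 'r) seq_object" and I :: "('s, 'x, 'v, 'o, 'r) implementation"
  assumes three: "n \<ge> 3"
    and states_distinct: "distinct [s, s0, s1]"
    and ops_distinct: "a0 \<noteq> a1"
    and responses_distinct: "r0 \<noteq> r1"
    and X_eq: "X = consensus_object s s0 s1 a0 a1 r0 r1"
    and lin: "linearizable n X I"
    and cof: "conflict_obstruction_free n X I"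
begin

definition proposal :: "nat \<Rightarrow> 'o" where
  "proposal p = (if p = 2 then a1 else a0)"

text \<open>Every process is placed just after its invocation. An invocation touches only local
  state, so \<open>config_of\<close> can undo it for processes that have not invoked yet.\<close>

definition initial_system :: "('s, 'x, 'v, 'r) system" where
  "initial_system =
     \<lparr>view = (\<lambda>p. (start I p (init_local I p) (proposal p), None)), mem = init_memory I\<rparr>"

text \<open>The configuration in which only the processes in \<open>P\<close> have made their invocation.\<close>

definition config_of :: "nat set \<Rightarrow> ('s, 'x, 'v, 'r) system \<Rightarrow> ('s, 'x, 'v, 'o) config" where
  "config_of P c =
     \<lparr>local_state = (\<lambda>p. if p \<in> P then fst (view c p) else init_local I p),
      memory = mem c,
      pending = (\<lambda>p. if p \<in> P \<and> decision c p = None then Some (proposal p) else None)\<rparr>"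

lemma config_of_initial: "config_of {} initial_system = initial_config I"
  by (simp add: config_of_def initial_system_def initial_config_def)

text \<open>The system \<open>c\<close> is the same on both sides: invoking only enlarges
  \<open>P\<close>.\<close>

lemma transition_invoke:
  assumes "p < n" "p \<notin> P" "view c p = view initial_system p"
  shows "transition n X I (config_of P c) (Invoke p (proposal p)) (config_of (insert p P) c)"
proof -
  have "config_of (insert p P) c = (config_of P c)
      \<lparr>local_state := (local_state (config_of P c))
          (p := start I p (local_state (config_of P c) p) (proposal p)),
        pending := (pending (config_of P c))(p := Some (proposal p))\<rparr>"
    using assms by (auto simp: config_of_def initial_system_def fun_eq_iff)
  then show ?thesis
    using assms transition.invoke[of p n "proposal p" X "config_of P c" I]
    by (auto simp: config_of_def X_eq consensus_object_def proposal_def)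
qed

lemma transition_step:
  assumes "p < n" "p \<in> P" "decision c p = None"
  shows "transition n X I (config_of P c) (Step p (decision (sys_step I p c) p))
    (config_of P (sys_step I p c))"
proof (cases "access I p (fst (view c p))")
  case (Read x)
  obtain t ro where upd: "update I p (fst (view c p)) (Some (mem c x)) = (t, ro)"
    by (cases "update I p (fst (view c p)) (Some (mem c x))")
  have "config_of P (sys_step I p c) = (config_of P c)
      \<lparr>local_state := (local_state (config_of P c))(p := t),
        pending := (if ro = None then pending (config_of P c)
          else (pending (config_of P c))(p := None))\<rparr>"
    using assms Read upd by (auto simp: config_of_def sys_step_def fun_eq_iff)
  moreover have "decision (sys_step I p c) p = ro"
    using assms Read upd by (simp add: sys_step_def)
  ultimately show ?thesis
    using assms Read upd transition.read_step[of p n "config_of P c" I x t ro X]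
    by (simp add: config_of_def)
next
  case (Write x v)
  obtain t ro where upd: "update I p (fst (view c p)) None = (t, ro)"
    by (cases "update I p (fst (view c p)) None")
  have "config_of P (sys_step I p c) = (config_of P c)
      \<lparr>local_state := (local_state (config_of P c))(p := t),
        memory := (memory (config_of P c))(x := v),
        pending := (if ro = None then pending (config_of P c)
          else (pending (config_of P c))(p := None))\<rparr>"
    using assms Write upd by (auto simp: config_of_def sys_step_def fun_eq_iff)
  moreover have "decision (sys_step I p c) p = ro"
    using assms Write upd by (simp add: sys_step_def)
  ultimately show ?thesis
    using assms Write upd transition.write_step[of p n "config_of P c" I x v t ro X]
    by (simp add: config_of_def)
qed

section \<open>Correspondence between systems and executions\<close>

definition instance_status :: "('o, 'r) action list \<Rightarrow> nat \<Rightarrow> 'r option \<Rightarrow> bool" where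
  "instance_status \<alpha> p ro \<longleftrightarrow>
     (\<exists>i < length \<alpha>. \<alpha> ! i = Invoke p (proposal p) \<and>
        (case ro of None \<Rightarrow> \<forall>r. Step p (Some r) \<notin> set \<alpha>
         | Some u \<Rightarrow> \<exists>k < length \<alpha>. returns_at ((!) \<alpha>) i k u))"

text \<open>The invariant tying a system to an actual execution. The statuses feed linearizability
  and conflict-obstruction-freedom; processes outside \<open>P\<close> are untouched, so they can
  still invoke; the last conjunct limits which operations a linearization can contain.\<close>

definition realizes ::
    "nat set \<Rightarrow> ('o, 'r) action list \<Rightarrow> ('s, 'x, 'v, 'r) system \<Rightarrow> bool" where
  "realizes P \<alpha> c \<longleftrightarrow>
     leads_to n X I \<alpha> (config_of P c) \<and> P \<subseteq> {..<n} \<and>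
     (\<forall>p\<in>P. instance_status \<alpha> p (decision c p)) \<and>
     (\<forall>p. p \<notin> P \<longrightarrow> view c p = view initial_system p \<and> (\<forall>ro. Step p ro \<notin> set \<alpha>)) \<and>
     (\<forall>p a. Invoke p a \<in> set \<alpha> \<longrightarrow> p \<in> P \<and> a = proposal p)"

lemma realizes_initial: "realizes {} [] initial_system"
  by (simp add: realizes_def config_of_initial leads_to_Nil)

lemma instance_status_snoc:
  assumes "instance_status \<alpha> p ro" "\<And>r. ro = None \<Longrightarrow> e \<noteq> Step p (Some r)"
  shows "instance_status (\<alpha> @ [e]) p ro"
proof -
  obtain i where i: "i < length \<alpha>" "\<alpha> ! i = Invoke p (proposal p)"
    "case ro of None \<Rightarrow> \<forall>r. Step p (Some r) \<notin> set \<alpha>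
       | Some u \<Rightarrow> \<exists>k < length \<alpha>. returns_at ((!) \<alpha>) i k u"
    using assms(1) by (auto simp: instance_status_def)
  show ?thesis
    unfolding instance_status_def
  proof (intro exI[of _ i] conjI)
    show "case ro of None \<Rightarrow> \<forall>r. Step p (Some r) \<notin> set (\<alpha> @ [e])
       | Some u \<Rightarrow> \<exists>k < length (\<alpha> @ [e]). returns_at ((!) (\<alpha> @ [e])) i k u"
    proof (cases ro)
      case None
      then show ?thesis using i assms(2) by auto
    next
      case (Some u)
      then obtain k where "k < length \<alpha>" "returns_at ((!) \<alpha>) i k u" using i by auto
      then show ?thesis using Some by (auto simp: returns_at_append intro!: exI[of _ k])
    qed
  qed (use i in \<open>auto simp: nth_append\<close>)
qed

lemma instance_status_return:
  assumes "instance_status \<alpha> p None"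
  shows "instance_status (\<alpha> @ [Step p (Some u)]) p (Some u)"
proof -
  obtain i where i: "i < length \<alpha>" "\<alpha> ! i = Invoke p (proposal p)"
    "\<forall>r. Step p (Some r) \<notin> set \<alpha>"
    using assms by (auto simp: instance_status_def)
  have "returns_at ((!) (\<alpha> @ [Step p (Some u)])) i (length \<alpha>) u"
    using i by (auto simp: returns_at_def step_of_def nth_append) (metis nth_mem)
  moreover have "(\<alpha> @ [Step p (Some u)]) ! i = Invoke p (proposal p)"
    using i by (simp add: nth_append)
  ultimately show ?thesis
    using i(1) unfolding instance_status_def option.case length_append_singleton
    by (meson lessI less_SucI)
qed

lemma realizes_invoke:
  assumes "realizes P \<alpha> c" "p < n" "p \<notin> P"
  shows "realizes (insert p P) (\<alpha> @ [Invoke p (proposal p)]) c"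
proof -
  have "view c p = view initial_system p" "\<And>ro. Step p ro \<notin> set \<alpha>"
    using assms by (auto simp: realizes_def)
  moreover from this have "instance_status (\<alpha> @ [Invoke p (proposal p)]) p (decision c p)"
    by (auto simp: instance_status_def initial_system_def nth_append intro!: exI[of _ "length \<alpha>"])
  ultimately show ?thesis
    using assms leads_to_snoc transition_invoke[of p P c]
    unfolding realizes_def by (auto intro: instance_status_snoc)
qed

lemma realizes_undecided_step:
  assumes "realizes P \<alpha> c" "p \<in> P" "decision c p = None"
  shows "realizes P (\<alpha> @ [Step p (decision (sys_step I p c) p)]) (sys_step I p c)"
proof -
  let ?e = "Step p (decision (sys_step I p c) p)"
  have "instance_status (\<alpha> @ [?e]) q (decision (sys_step I p c) q)" if "q \<in> P" for q
  proof (cases "q = p")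
    case False
    then show ?thesis
      using assms that by (auto simp: realizes_def intro!: instance_status_snoc)
  next
    case True
    have "instance_status \<alpha> p None"
      using assms by (auto simp: realizes_def)
    then show ?thesis
      using True by (cases "decision (sys_step I p c) p")
        (auto intro: instance_status_snoc instance_status_return)
  qed
  moreover have "leads_to n X I (\<alpha> @ [?e]) (config_of P (sys_step I p c))"
    using assms by (intro leads_to_snoc[OF _ transition_step]) (auto simp: realizes_def)
  moreover have "view (sys_step I p c) q = view c q" if "q \<notin> P" for q
    using assms(2) that by (intro view_sys_step_other) auto
  ultimately show ?thesis
    using assms unfolding realizes_def by auto
qed

text \<open>A decided process idles in the system but takes no step in the execution, so
  \<open>\<beta>\<close> may be shorter than \<open>k\<close>.\<close>

lemma realizes_run:
  assumes "realizes P \<alpha> c" "p \<in> P"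
  obtains \<beta> where "realizes P (\<alpha> @ \<beta>) ((sys_step I p ^^ k) c)"
    and "\<And>q a. Invoke q a \<notin> set \<beta>"
proof -
  have "\<exists>\<beta>. realizes P (\<alpha> @ \<beta>) ((sys_step I p ^^ k) c) \<and> (\<forall>q a. Invoke q a \<notin> set \<beta>)"
  proof (induction k)
    case 0
    then show ?case using assms(1) by (auto intro!: exI[of _ "[]"])
  next
    case (Suc k)
    then obtain \<beta> where \<beta>: "realizes P (\<alpha> @ \<beta>) ((sys_step I p ^^ k) c)"
      "\<forall>q a. Invoke q a \<notin> set \<beta>" by blast
    let ?c = "(sys_step I p ^^ k) c"
    show ?case
    proof (cases "decision ?c p")
      case None
      then show ?thesis
        using realizes_undecided_step[OF \<beta>(1) assms(2)] \<beta>(2)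
        by (intro exI[of _ "\<beta> @ [Step p (decision (sys_step I p ?c) p)]"]) simp
    next
      case (Some u)
      then show ?thesis using \<beta> by auto
    qed
  qed
  then show thesis using that by blast
qed

section \<open>Consequences of linearizability\<close>

text \<open>Decisions become entries of a linearization. The positions of invocation and return are
  exported so that the instance can be located again in another linearization or in a longer
  execution.\<close>

lemma linearization_response:
  assumes "realizes P \<alpha> c" "p \<in> P" "decision c p = Some u"
  obtains i k L where "linearization X \<alpha> L" "(i, proposal p, u) \<in> set L"
    and "i < length \<alpha>" "\<alpha> ! i = Invoke p (proposal p)" "k < length \<alpha>" "returns_at ((!) \<alpha>) i k u"
proof -
  obtain L where L: "linearization X \<alpha> L"
    using assms(1) lin leads_to_finite_execution[of n X I \<alpha>]
    unfolding realizes_def linearizable_def by blast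
  moreover obtain i k where "i < length \<alpha>" "\<alpha> ! i = Invoke p (proposal p)" "k < length \<alpha>"
    "returns_at ((!) \<alpha>) i k u"
    using assms unfolding realizes_def instance_status_def by fastforce
  moreover from this L have "(i, proposal p, u) \<in> set L"
    unfolding linearization_def by blast
  ultimately show thesis using that by blast
qed

text \<open>Transfers \<open>legal_consensus_first\<close> to linearizations: the winner is read off
  the head.\<close>

lemma linearization_responses_first:
  assumes "linearization X \<alpha> L" "(i, a, u) \<in> set L"
  obtains j b v L' where "L = (j, b, v) # L'" "u = (if b = a0 then r0 else r1)"
proof -
  obtain j b v L' where L: "L = (j, b, v) # L'"
    using assms(2) by (cases L) auto
  have "legal (consensus_object s s0 s1 a0 a1 r0 r1) s ((b, v) # map snd L')"
    using assms(1) L by (simp add: linearization_def X_eq consensus_object_def)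
  moreover have "(a, u) \<in> set ((b, v) # map snd L')"
    using assms(2) L by force
  ultimately have "u = (if b = a0 then r0 else r1)"
    using legal_consensus_first[OF states_distinct] by (metis fst_conv)
  with L show thesis by (rule that)
qed

lemma agreement:
  assumes "realizes P \<alpha> c" "p \<in> P" "q \<in> P" "decision c p = Some u" "decision c q = Some v"
  shows "u = v"
proof -
  obtain i k L where L: "linearization X \<alpha> L" "(i, proposal p, u) \<in> set L"
    using linearization_response[OF assms(1,2,4)] by metis
  obtain j l where "j < length \<alpha>" "\<alpha> ! j = Invoke q (proposal q)" "l < length \<alpha>"
    "returns_at ((!) \<alpha>) j l v"
    using linearization_response[OF assms(1,3,5)] by metis
  \<comment> \<open>The linearization that came with \<open>v\<close> may differ from
    \<open>L\<close>; being complete, the instance of \<open>q\<close> is in \<open>L\<close> as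
    well.\<close>
  then have "(j, proposal q, v) \<in> set L"
    using L(1) unfolding linearization_def by blast
  then obtain i' b w L' where "L = (i', b, w) # L'" "v = (if b = a0 then r0 else r1)"
    using linearization_responses_first[OF L(1)] by metis
  moreover obtain j' b' w' L'' where "L = (j', b', w') # L''" "u = (if b' = a0 then r0 else r1)"
    using linearization_responses_first[OF L] by metis
  ultimately show ?thesis by simp
qed

text \<open>Only process 0 has invoked, so the head of any linearization carries
  \<open>a0\<close>.\<close>

lemma validity_alone:
  assumes "realizes {0} \<alpha> c" "decision c 0 = Some u"
  shows "u = r0"
proof -
  obtain i L where L: "linearization X \<alpha> L" "(i, proposal 0, u) \<in> set L"
    using linearization_response[OF assms(1) _ assms(2)] by blast
  obtain j b v L' where first: "L = (j, b, v) # L'" "u = (if b = a0 then r0 else r1)"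
    using linearization_responses_first[OF L] by metis
  then obtain p where "j < length \<alpha>" "\<alpha> ! j = Invoke p b"
    using L(1) by (auto simp: linearization_def)
  then have "p \<in> {0}" "b = proposal p"
    using assms(1) nth_mem[of j \<alpha>] unfolding realizes_def by auto
  then show ?thesis using first by (simp add: proposal_def)
qed

text \<open>Real-time order decides: process 2 returns within \<open>\<alpha>\<close>, before any
  \<open>a0\<close> is invoked, so no instance of \<open>a0\<close> can head the
  linearization.\<close>

lemma validity_after:
  assumes before: "realizes {2} \<alpha> c" "decision c 2 \<noteq> None"
    and after: "realizes {0, 2} (\<alpha> @ \<beta>) d" "decision d 0 = Some u"
  shows "u = r1"
proof -
  obtain w where "decision c 2 = Some w" using before(2) by blast
  then obtain i k where i: "i < length \<alpha>" "\<alpha> ! i = Invoke 2 (proposal 2)" "k < length \<alpha>"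
    "returns_at ((!) \<alpha>) i k w"
    using linearization_response[OF before(1)] by blast
  then have ret: "returns_at ((!) (\<alpha> @ \<beta>)) i k w"
    by (simp add: returns_at_append)
  obtain i' L where L: "linearization X (\<alpha> @ \<beta>) L" "(i', proposal 0, u) \<in> set L"
    using linearization_response[OF after(1) _ after(2)] by blast
  obtain j b v L' where first: "L = (j, b, v) # L'" "u = (if b = a0 then r0 else r1)"
    using linearization_responses_first[OF L] by metis
  have "(\<alpha> @ \<beta>) ! i = Invoke 2 (proposal 2)" "k < length (\<alpha> @ \<beta>)"
    using i by (auto simp: nth_append)
  then have iL: "(i, proposal 2, w) \<in> set L"
    using L(1) ret unfolding linearization_def by blast
  have "b \<noteq> a0"
  proof
    assume b: "b = a0"
    obtain p where j: "j < length (\<alpha> @ \<beta>)" "(\<alpha> @ \<beta>) ! j = Invoke p a0"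
      using L(1) first b by (auto simp: linearization_def)
    have "\<not> j < length \<alpha>"
    proof
      assume "j < length \<alpha>"
      then have "Invoke p a0 \<in> set \<alpha>" using j nth_mem[of j \<alpha>] by (simp add: nth_append)
      then show False
        using before(1) ops_distinct unfolding realizes_def proposal_def by fastforce
    qed
    then have "precedes (\<alpha> @ \<beta>) i j"
      using j(1) i(3) ret unfolding precedes_def by (meson le_less_trans not_le order.strict_trans1)
    \<comment> \<open>The operation of this entry is \<open>a1\<close>, so it is not the head; it
      then stands behind \<open>j\<close> in \<open>L\<close>, although \<open>i\<close> precedes
      \<open>j\<close>.\<close>
    moreover have "(i, proposal 2, w) \<in> set L'"
      using iL first(1) b ops_distinct by (auto simp: proposal_def)
    ultimately show False
      using L(1) first(1) by (auto simp: linearization_def)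
  qed
  then show ?thesis using first(2) by simp
qed

section \<open>Consequences of conflict-obstruction-freedom\<close>

text \<open>The only use of conflict-obstruction-freedom. With a common proposal, no steps after
  \<open>\<alpha>\<close> conflict, so a process scheduled infinitely often would have to
  return.\<close>

lemma no_infinite_undecided_run:
  assumes "realizes P \<alpha> c0" "finite P" "c 0 = c0"
    and steps: "\<And>k. c (Suc k) = sys_step I (f k) (c k)"
    and undecided: "\<And>k. f k \<in> P \<and> decision (c k) (f k) = None"
    and same: "\<And>k l. proposal (f k) = proposal (f l)"
  shows False
proof -
  let ?m = "length \<alpha>"
  define e :: "nat \<Rightarrow> ('o, 'r) action" where "e k = Step (f k) (decision (c (Suc k)) (f k))" for k
  define \<omega> where "\<omega> k = (if k < ?m then \<alpha> ! k else e (k - ?m))" for k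
  have "P \<subseteq> {..<n}" using assms(1) by (simp add: realizes_def)
  then have "transition n X I (config_of P (c k)) (e k) (config_of P (c (Suc k)))" for k
    using transition_step[of "f k" P "c k"] undecided[of k] steps[of k] by (auto simp: e_def)
  then have inf: "infinite_execution n X I \<omega>"
    using leads_to_infinite_execution[of n X I \<alpha> "\<lambda>k. config_of P (c k)" e] assms(1,3)
    by (auto simp: \<omega>_def[abs_def] realizes_def)
  have persist: "decision (c (k + l)) q = Some u" if "decision (c k) q = Some u" for k l q u
    using that by (induction l) (auto simp: steps intro: decision_sys_step)
  have "range f \<subseteq> P" using undecided by auto
  then have "finite (range f)" using assms(2) finite_subset by blast
  \<comment> \<open>Only finitely many processes are scheduled, so some \<open>p\<close> recurs
    forever and is correct in \<open>\<omega>\<close>.\<close>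
  then obtain k0 where "infinite {k. f k = f k0}"
    using pigeonhole_infinite[of UNIV f] by auto
  then obtain p where p: "infinite {k. f k = p}" by blast
  then obtain k1 where "f k1 = p" using not_finite_existsD by blast
  then have pP: "p \<in> P" and pu: "decision (c k1) p = None" using undecided by auto
  \<comment> \<open>\<open>p\<close> is still undecided at index \<open>k1\<close> and decisions
    persist, so its instance is pending at the end of \<open>\<alpha>\<close>.\<close>
  have "decision c0 p = None"
    using persist[of 0 p _ k1] pu assms(3) by (cases "decision c0 p") auto
  then obtain i where i: "i < ?m" "\<alpha> ! i = Invoke p (proposal p)" "\<And>r. Step p (Some r) \<notin> set \<alpha>"
    using assms(1) pP unfolding realizes_def instance_status_def by fastforce
  have \<omega>i: "\<omega> i = Invoke p (proposal p)" using i by (simp add: \<omega>_def)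
  have "infinite ((\<lambda>k. k + ?m) ` {k. f k = p})"
    using p by (simp add: finite_image_iff)
  moreover have "(\<lambda>k. k + ?m) ` {k. f k = p} \<subseteq> {k. \<exists>ro. \<omega> k = Step p ro}"
    by (auto simp: \<omega>_def e_def)
  ultimately have "correct \<omega> p"
    unfolding correct_def using finite_subset by blast
  moreover have "\<not> step_of \<omega> j k" if k: "k \<ge> ?m" and \<omega>: "\<omega> i = Invoke q a" "\<omega> j = Invoke q' b"
    and conf: "conflict X a b" for k j q q' a b
  proof
    assume "step_of \<omega> j k"
    then have "\<exists>ro. \<omega> k = Step q' ro" using \<omega> by (auto simp: step_of_def)
    then have q': "q' = f (k - ?m)" using k by (auto simp: \<omega>_def e_def)
    \<comment> \<open>\<open>e\<close> contains no invocations, so every instance was invoked within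
      \<open>\<alpha>\<close>, where only proposals occur.\<close>
    have "j < ?m" using \<omega>(2) by (auto simp: \<omega>_def e_def split: if_splits)
    then have "Invoke q' b \<in> set \<alpha>" using \<omega>(2) nth_mem[of j \<alpha>] by (simp add: \<omega>_def)
    then have "b = proposal q'" using assms(1) by (simp add: realizes_def)
    then have "b = a"
      using q' \<omega>(1) \<omega>i same[of "k - ?m" k1] \<open>f k1 = p\<close>
      by (metis action.inject(1))
    then show False
      using conf consensus_object_no_self_conflict[OF states_distinct] X_eq by metis
  qed
  then have "eventually_conflict_step_contention_free X \<omega> i"
    unfolding eventually_conflict_step_contention_free_def by blast
  ultimately have "completes \<omega> i"
    using cof inf \<omega>i unfolding conflict_obstruction_free_def by blast
  then obtain k r where "returns_at \<omega> i k r" by (auto simp: completes_def)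
  then have k: "\<omega> k = Step p (Some r)"
    using \<omega>i by (auto simp: returns_at_def step_of_def)
  show False
  proof (cases "k < ?m")
    case True
    then show False using k i(3) nth_mem[of k \<alpha>] by (simp add: \<omega>_def)
  next
    case False
    then have dec: "decision (c (Suc (k - ?m))) p = Some r"
      using k by (auto simp: \<omega>_def e_def)
    \<comment> \<open>\<open>p\<close> is scheduled again after its decision, although scheduled
      processes are undecided.\<close>
    obtain k' where k': "k' > Suc (k - ?m)" "f k' = p"
      using p unfolding infinite_nat_iff_unbounded by blast
    then show False
      using persist[OF dec, of "k' - Suc (k - ?m)"] undecided[of k'] by simp
  qed
qed

text \<open>A constant schedule has only one proposal, so conflict-obstruction-freedom yields
  obstruction-freedom.\<close>

lemma solo_terminates:
  assumes "realizes P \<alpha> c" "finite P" "p \<in> P"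
  obtains k u where "decision ((sys_step I p ^^ k) c) p = Some u"
proof (rule ccontr)
  assume "\<not> thesis"
  then have "decision ((sys_step I p ^^ k) c) p = None" for k
    using that by (cases "decision ((sys_step I p ^^ k) c) p") auto
  then show False
    using no_infinite_undecided_run[OF assms(1,2), of "\<lambda>k. (sys_step I p ^^ k) c" "\<lambda>_. p"]
      assms(3) by simp
qed

section \<open>Configurations reachable after all three invocations\<close>

definition reachable :: "('s, 'x, 'v, 'r) system \<Rightarrow> bool" where
  "reachable c \<longleftrightarrow> (\<exists>\<alpha>. realizes {0, 1, 2} \<alpha> c)"

lemma reachable_initial: "reachable initial_system"
proof -
  \<comment> \<open>The order 2, 1, 0 makes the successive \<open>insert\<close>s produce
    \<open>{0, 1, 2}\<close> literally.\<close>
  have 2: "realizes {2} ([] @ [Invoke 2 (proposal 2)]) initial_system"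
    by (rule realizes_invoke[OF realizes_initial]) (use three in auto)
  have 1: "realizes {1, 2} (([] @ [Invoke 2 (proposal 2)]) @ [Invoke 1 (proposal 1)])
      initial_system"
    by (rule realizes_invoke[OF 2]) (use three in auto)
  have "realizes {0, 1, 2} ((([] @ [Invoke 2 (proposal 2)]) @ [Invoke 1 (proposal 1)]) @
      [Invoke 0 (proposal 0)]) initial_system"
    by (rule realizes_invoke[OF 1]) (use three in auto)
  then show ?thesis unfolding reachable_def by blast
qed

lemma reachable_run: "reachable c \<Longrightarrow> p \<in> {0, 1, 2} \<Longrightarrow> reachable ((sys_step I p ^^ k) c)"
  unfolding reachable_def using realizes_run by metis

lemma reachable_step: "reachable c \<Longrightarrow> p \<in> {0, 1, 2} \<Longrightarrow> reachable (sys_step I p c)"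
  using reachable_run[of c p 1] by simp

text \<open>Together with \<open>solo_outcome_unique\<close> this makes the outcome a function on
  reachable systems.\<close>

lemma solo_outcome_exists:
  assumes "reachable c" "p \<in> {0, 1, 2}"
  obtains u where "solo_outcome I p c u"
proof -
  obtain \<alpha> where "realizes {0, 1, 2} \<alpha> c" using assms(1) by (auto simp: reachable_def)
  from solo_terminates[OF this _ assms(2)] show thesis
    using that unfolding solo_outcome_def by blast
qed

text \<open>At the end of the solo run of \<open>q\<close> both processes have decided, and
  \<open>agreement\<close> applies.\<close>

lemma solo_outcome_of_decided:
  assumes "reachable c" "p \<in> {0, 1, 2}" "q \<in> {0, 1, 2}" "decision c p = Some u"
    and "solo_outcome I q c v"
  shows "v = u"
proof -
  obtain k where k: "decision ((sys_step I q ^^ k) c) q = Some v"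
    using assms(5) by (auto simp: solo_outcome_def)
  have "decision ((sys_step I q ^^ k) c) p = Some u"
    using decision_run[OF assms(4)] .
  moreover obtain \<alpha> where "realizes {0, 1, 2} \<alpha> ((sys_step I q ^^ k) c)"
    using reachable_run[OF assms(1,3)] by (auto simp: reachable_def)
  ultimately show ?thesis using agreement assms(2,3) k by blast
qed

section \<open>The valency argument\<close>

text \<open>Not bivalence over all extensions, but disagreement between the solo outcomes of 0 and
  1.\<close>

definition bivalent :: "('s, 'x, 'v, 'r) system \<Rightarrow> bool" where
  "bivalent c \<longleftrightarrow> reachable c \<and> (\<exists>u v. solo_outcome I 0 c u \<and> solo_outcome I 1 c v \<and> u \<noteq> v)"

text \<open>A decision would force both solo outcomes to equal it.\<close>

lemma bivalent_undecided:
  assumes "bivalent c" "p \<in> {0, 1}"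
  shows "decision c p = None"
proof (rule ccontr)
  assume "decision c p \<noteq> None"
  then obtain w where "decision c p = Some w" by blast
  moreover obtain u v where "reachable c" "solo_outcome I 0 c u" "solo_outcome I 1 c v" "u \<noteq> v"
    using assms(1) by (auto simp: bivalent_def)
  ultimately show False
    using assms(2) solo_outcome_of_decided[of c p 0 w u] solo_outcome_of_decided[of c p 1 w v]
    by auto
qed

text \<open>A step preserves the outcome of the process that takes it, so a single step can end the
  disagreement only by changing the outcome of the other process.\<close>

lemma bivalent_extends:
  assumes "bivalent c"
  shows "bivalent (sys_step I 0 c) \<or> bivalent (sys_step I 1 c) \<or>
    bivalent (sys_step I 1 (sys_step I 0 c))"
proof -
  obtain u v where uv: "reachable c" "solo_outcome I 0 c u" "solo_outcome I 1 c v" "u \<noteq> v"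
    using assms by (auto simp: bivalent_def)
  let ?d = "sys_step I 0 c" and ?e = "sys_step I 1 c"
  let ?de = "sys_step I 1 ?d" and ?ed = "sys_step I 0 ?e"
  have r: "reachable ?d" "reachable ?e" "reachable ?de"
    using uv(1) reachable_step by auto
  have 0: "solo_outcome I 0 ?d u" and 1: "solo_outcome I 1 ?e v"
    using uv by (auto simp: solo_outcome_step)
  show ?thesis
    using zero_neq_one
  proof (cases rule: sys_step_cases[of 0 1 I c])
    case commute
    obtain v' where v': "solo_outcome I 1 ?d v'" using solo_outcome_exists[of ?d 1] r by blast
    obtain u' where u': "solo_outcome I 0 ?e u'" using solo_outcome_exists[of ?e 0] r by blast
    show ?thesis
    proof (cases "v' = u \<and> u' = v")
      case False
      then show ?thesis using 0 1 v' u' r unfolding bivalent_def by metis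
    next
      case True
      \<comment> \<open>Each single step has made the outcomes agree, so after both steps they are
        exchanged: 1 has \<open>u\<close> and 0 has \<open>v\<close> in the common
        configuration.\<close>
      have "solo_outcome I 1 ?de u" "solo_outcome I 0 ?ed v"
        using True v' u' by (auto simp: solo_outcome_step)
      then show ?thesis using commute r uv(4) unfolding bivalent_def by metis
    qed
  next
    case hide_first
    \<comment> \<open>Process 1 cannot see whether 0 moved first, so its outcome \<open>v\<close>
      survives the step of 0.\<close>
    then have "solo_outcome I 1 ?de v"
      using 1 solo_outcome_agree[of 0 ?de ?e 1 I] by simp
    then have "solo_outcome I 1 ?d v" by (simp add: solo_outcome_step)
    then show ?thesis using 0 r uv(4) unfolding bivalent_def by blast
  next
    case hide_second
    then have "solo_outcome I 0 ?ed u"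
      using 0 solo_outcome_agree[of 1 ?ed ?d 0 I] by simp
    then have "solo_outcome I 0 ?e u" by (simp add: solo_outcome_step)
    then show ?thesis using 1 r uv(4) unfolding bivalent_def by blast
  qed
qed

lemma not_bivalent: "\<not> bivalent c"
proof
  assume "bivalent c"
  \<comment> \<open>\<open>bivalent_extends\<close> may need two steps, 0 and then 1.
    \<open>B\<close> therefore also admits the system in between, where a step of 1 restores the
    disagreement.\<close>
  define B where "B d \<longleftrightarrow> reachable d \<and> (bivalent d \<or> bivalent (sys_step I 1 d))" for d
  have extend: "\<exists>p\<in>{0, 1}. decision d p = None \<and> B (sys_step I p d)" if "B d" for d
  proof (cases "bivalent d")
    case True
    then show ?thesis
      using bivalent_extends[OF True] bivalent_undecided[OF True] reachable_step[of d] that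
      unfolding B_def by auto
  next
    case False
    then have "bivalent (sys_step I 1 d)" using that by (simp add: B_def)
    \<comment> \<open>If 1 had decided, its step would be idle and \<open>d\<close> itself would be
      bivalent.\<close>
    moreover from this False have "decision d 1 = None"
      by (cases "decision d 1") auto
    ultimately show ?thesis by (auto simp: B_def bivalent_def)
  qed
  then obtain g where g: "\<And>d. B d \<Longrightarrow> g d \<in> {0, 1} \<and> decision d (g d) = None \<and> B (sys_step I (g d) d)"
    by metis
  define cs where "cs = rec_nat c (\<lambda>_ d. sys_step I (g d) d)"
  have cs: "cs 0 = c" "cs (Suc k) = sys_step I (g (cs k)) (cs k)" for k
    by (simp_all add: cs_def)
  have B: "B (cs k)" for k
  proof (induction k)
    case 0
    have "reachable c" using \<open>bivalent c\<close> by (simp add: bivalent_def)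
    then show ?case using \<open>bivalent c\<close> by (simp add: cs B_def)
  next
    case (Suc k)
    then show ?case using g[OF Suc] by (simp add: cs)
  qed
  obtain \<alpha> where "realizes {0, 1, 2} \<alpha> c"
    using \<open>bivalent c\<close> by (auto simp: bivalent_def reachable_def)
  moreover have "g (cs k) \<in> {0, 1, 2} \<and> decision (cs k) (g (cs k)) = None" for k
    using g[OF B, of k] by blast
  \<comment> \<open>Process 2 is never scheduled, so all steps of the run belong to proposals of
    \<open>a0\<close>.\<close>
  moreover have "proposal (g (cs k)) = a0" for k
    using g[OF B, of k] by (auto simp: proposal_def)
  ultimately show False
    using no_infinite_undecided_run[of "{0, 1, 2}" \<alpha> c cs "\<lambda>k. g (cs k)"] cs by simp
qed

text \<open>Lets process 1 stand in for process 0 when a step of 0 is hidden from everyone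
  else.\<close>

lemma solo_outcomes_equal:
  assumes "reachable c"
  shows "solo_outcome I 0 c u \<longleftrightarrow> solo_outcome I 1 c u"
proof -
  obtain v w where "solo_outcome I 0 c v" "solo_outcome I 1 c w"
    using solo_outcome_exists[OF assms] by (metis insertCI)
  then show ?thesis
    using not_bivalent[of c] assms solo_outcome_unique unfolding bivalent_def by metis
qed

text \<open>Evaluated in an execution where only 0 has invoked. The outcome belongs to the system
  alone, so it is also \<open>r0\<close> when the others have invoked.\<close>

lemma initial_outcome: "solo_outcome I 0 initial_system r0"
proof -
  have real: "realizes {0} ([] @ [Invoke 0 (proposal 0)]) initial_system"
    by (rule realizes_invoke[OF realizes_initial]) (use three in auto)
  obtain k u where k: "decision ((sys_step I 0 ^^ k) initial_system) 0 = Some u"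
    by (rule solo_terminates[OF real _ insertI1]) simp
  obtain \<beta> where "realizes {0} \<beta> ((sys_step I 0 ^^ k) initial_system)"
    by (rule realizes_run[OF real insertI1])
  then have "u = r0" using k by (rule validity_alone)
  then show ?thesis using k unfolding solo_outcome_def by blast
qed

text \<open>Process 0 invokes only after 2 has decided, so real-time order forces \<open>r1\<close>;
  the system is the same as when all invoke at the start.\<close>

lemma final_outcome:
  obtains k where "solo_outcome I 0 ((sys_step I 2 ^^ k) initial_system) r1"
proof -
  have real2: "realizes {2} ([] @ [Invoke 2 (proposal 2)]) initial_system"
    by (rule realizes_invoke[OF realizes_initial]) (use three in auto)
  obtain k w where k: "decision ((sys_step I 2 ^^ k) initial_system) 2 = Some w"
    by (rule solo_terminates[OF real2 _ insertI1]) simp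
  let ?c = "(sys_step I 2 ^^ k) initial_system"
  obtain \<alpha> where \<alpha>: "realizes {2} \<alpha> ?c"
    by (rule realizes_run[OF real2 insertI1])
  have real0: "realizes {0, 2} (\<alpha> @ [Invoke 0 (proposal 0)]) ?c"
    by (rule realizes_invoke[OF \<alpha>]) (use three in auto)
  obtain l u where l: "decision ((sys_step I 0 ^^ l) ?c) 0 = Some u"
    by (rule solo_terminates[OF real0 _ insertI1]) simp
  obtain \<beta> where "realizes {0, 2} ((\<alpha> @ [Invoke 0 (proposal 0)]) @ \<beta>) ((sys_step I 0 ^^ l) ?c)"
    by (rule realizes_run[OF real0 insertI1])
  then have "realizes {0, 2} (\<alpha> @ [Invoke 0 (proposal 0)] @ \<beta>) ((sys_step I 0 ^^ l) ?c)"
    by simp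
  moreover have "decision ?c 2 \<noteq> None" using k by simp
  ultimately have "u = r1" using validity_after[OF \<alpha> _ _ l] by simp
  with l have "solo_outcome I 0 ?c r1" by (auto simp: solo_outcome_def)
  then show thesis by (rule that)
qed

lemma contradiction: False
proof -
  let ?c = "\<lambda>k. (sys_step I 2 ^^ k) initial_system"
  obtain K where "solo_outcome I 0 (?c K) r1" using final_outcome .
  then have K: "\<not> solo_outcome I 0 (?c K) r0"
    using solo_outcome_unique responses_distinct by metis
  have "solo_outcome I 0 (?c 0) r0" using initial_outcome by simp
  \<comment> \<open>A critical step of process 2: the outcome is \<open>r0\<close> before it and no
    longer after it.\<close>
  then obtain k where k: "solo_outcome I 0 (?c k) r0" "\<not> solo_outcome I 0 (?c (Suc k)) r0"
    using K by (induction K) auto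
  define d where "d j = (sys_step I 0 ^^ j) (?c k)" for j
  have reach: "reachable (d j)" for j
    unfolding d_def using reachable_initial by (intro reachable_run) auto
  have out: "solo_outcome I 0 (d j) r0" for j
    using k(1) by (induction j) (simp_all add: d_def solo_outcome_step)
  have d0: "sys_step I 2 (d 0) = ?c (Suc k)" by (simp add: d_def)
  obtain v where v: "solo_outcome I 0 (sys_step I 2 (d 0)) v"
    using solo_outcome_exists[OF reachable_step[OF reach]] by blast
  then have "v \<noteq> r0" using k(2) d0 by auto
  have late: "solo_outcome I 0 (sys_step I 2 (d j)) v" for j
  proof (induction j)
    case 0
    show ?case using v .
  next
    case (Suc j)
    let ?d = "d j"
    have dSuc: "d (Suc j) = sys_step I 0 ?d" by (simp add: d_def)
    have "(2 :: nat) \<noteq> 0" by simp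
    then show ?case
    proof (cases rule: sys_step_cases[of 2 0 I ?d])
      case commute
      \<comment> \<open>Here \<open>d (Suc j)\<close> followed by the step of 2 is reached by a step
        of 0 from \<open>sys_step I 2 (d j)\<close>, which keeps the outcome of 0.\<close>
      then show ?thesis using Suc by (simp add: dSuc solo_outcome_step)
    next
      case hide_first
      \<comment> \<open>The step of 0 erases that of 2, so \<open>v\<close> would be the outcome of
        0 in \<open>d (Suc j)\<close>, where it is \<open>r0\<close>.\<close>
      then have "solo_outcome I 0 (d (Suc j)) v"
        using Suc solo_outcome_agree[OF hide_first, of 0 I] by (simp add: dSuc solo_outcome_step)
      then show ?thesis using out solo_outcome_unique \<open>v \<noteq> r0\<close> by metis
    next
      case hide_second
      \<comment> \<open>The step of 0 is hidden from 1 but not from 0, so the outcome is passed to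
        1, carried over there, and passed back to 0.\<close>
      have "solo_outcome I 1 (sys_step I 2 ?d) v"
        using Suc solo_outcomes_equal[OF reachable_step[OF reach]] by auto
      then have "solo_outcome I 1 (sys_step I 2 (d (Suc j))) v"
        using solo_outcome_agree[OF hide_second, of 1 I] by (simp add: dSuc)
      then show ?thesis
        using solo_outcomes_equal[OF reachable_step[OF reach]] by auto
    qed
  qed
  obtain j where "decision (d j) 0 = Some r0"
    using k(1) by (auto simp: solo_outcome_def d_def)
  \<comment> \<open>A step of 2 cannot revoke the decision of 0.\<close>
  then have "solo_outcome I 0 (sys_step I 2 (d j)) r0"
    by (intro solo_outcome_decided decision_sys_step)
  then show False using solo_outcome_unique[OF late] \<open>v \<noteq> r0\<close> by simp
qed

end

theorem corollary7:
  fixes n :: nat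
  assumes "n \<ge> 3"
    and "infinite (UNIV :: 'q set)" and "infinite (UNIV :: 'o set)" and "infinite (UNIV :: 'r set)"
  shows "\<not> (\<exists>U :: ('q, 'o, 'r) seq_object \<Rightarrow> ('s, 'x, 'v, 'o, 'r) implementation.
           universal_construction n U \<and> conflict_obstruction_free_construction n U)"
proof
  assume "\<exists>U :: ('q, 'o, 'r) seq_object \<Rightarrow> ('s, 'x, 'v, 'o, 'r) implementation.
    universal_construction n U \<and> conflict_obstruction_free_construction n U"
  then obtain U :: "('q, 'o, 'r) seq_object \<Rightarrow> ('s, 'x, 'v, 'o, 'r) implementation"
    where U: "universal_construction n U" "conflict_obstruction_free_construction n U" by blast
  define s :: 'q and a0 :: 'o and r0 :: 'r where "s = undefined" "a0 = undefined" "r0 = undefined"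
  \<comment> \<open>The infinite types supply three distinct states, two distinct operations and two
    distinct responses.\<close>
  obtain s0 where s0: "s0 \<notin> {s}"
    using ex_new_if_finite[OF assms(2), of "{s}"] by blast
  obtain s1 where s1: "s1 \<notin> {s, s0}"
    using ex_new_if_finite[OF assms(2), of "{s, s0}"] by blast
  obtain a1 where a1: "a1 \<notin> {a0}"
    using ex_new_if_finite[OF assms(3), of "{a0}"] by blast
  obtain r1 where r1: "r1 \<notin> {r0}"
    using ex_new_if_finite[OF assms(4), of "{r0}"] by blast
  let ?X = "consensus_object s s0 s1 a0 a1 r0 r1"
  have "sequential_object ?X" by (rule sequential_consensus_object)
  then have "linearizable n ?X (U ?X)" "conflict_obstruction_free n ?X (U ?X)"
    using U by (simp_all add: universal_construction_def conflict_obstruction_free_construction_def)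
  then interpret consensus_implementation n s s0 s1 a0 a1 r0 r1 ?X "U ?X"
    using assms(1) s0 s1 a1 r1 by unfold_locales auto
  show False by (rule contradiction)
qed

end
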